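(* Let $n\in\mathbb{N}$ and let $D=(d_1,d_2,\ldots,d_n)\in\mathbb{N}_0^n$ be a non-increasing sequence of non-negative integers such that $\mathcal{T}_D\neq\varnothing$. Then the greedy tree $GT_D$ attains the minimum Sombor index in $\mathcal{T}_D$, i.e. $\mathrm{SO}(GT_D)\le \mathrm{SO}(T)$ for every $T\in\mathcal{T}_D$.
   Context: All graphs are finite, simple and undirected; a graph of order $n$ has vertex set $\{1,2,\ldots,n\}$. For a graph $G$, the Sombor index is $\mathrm{SO}(G)=\sum_{u\sim v}\sqrt{\deg(u)^2+\deg(v)^2}$, the sum being over all unordered pairs of adjacent vertices. For a non-increasing sequence $D=(d_1,\ldots,d_n)$ of non-negative integers, $\mathcal{T}_D$ denotes the set of all trees on vertex set $\{1,\ldots,n\}$ with $\deg(u)=d_u$ for every $u\in\{1,\ldots,n\}$. The greedy tree $GT_D$ is the unique tree in $\mathcal{T}_D$ which, rooted at vertex $1$ and with the children of each vertex listed in increasing order of label, has breadth-first traversal $(1,2,3,\ldots,n)$: i.e. the root $1$ has children $2,3,\ldots,d_1+1$, vertex $2$ has the $d_2-1$ children $d_1+2,\ldots,d_1+d_2$, vertex $3$ has the next $d_3-1$ labels as children, and so on. *)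

theory Defs
  imports Complex_Main
begin

text \<open>A graph of order \<open>n\<close> has vertex set \<open>{1..n}\<close> and is represented by its set of edges, each
  edge being the unordered pair of its end vertices.  (In the AFP entry Graph_Theory
  undirected graphs are symmetric digraphs; its notion of a tree forbids directed cycles, hence
  also the two-cycle formed by an edge and its reverse, so it is not the undirected notion.)\<close>

type_synonym edges = "nat set set"

definition simple_graph :: "nat \<Rightarrow> edges \<Rightarrow> bool" where
  "simple_graph n E \<longleftrightarrow> (\<forall>e\<in>E. e \<subseteq> {1..n} \<and> card e = 2)"

definition deg :: "edges \<Rightarrow> nat \<Rightarrow> nat" where
  "deg E u = card {v. {u, v} \<in> E}"

definition connected_graph :: "nat \<Rightarrow> edges \<Rightarrow> bool" where
  "connected_graph n E \<longleftrightarrow> (\<forall>u\<in>{1..n}. \<forall>v\<in>{1..n}. (u, v) \<in> {(x, y). {x, y} \<in> E}\<^sup>*)"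

definition cycle :: "edges \<Rightarrow> nat list \<Rightarrow> bool" where
  "cycle E p \<longleftrightarrow> 3 \<le> length p \<and> distinct p \<and>
     (\<forall>i<length p. {p ! i, p ! (Suc i mod length p)} \<in> E)"

definition tree :: "nat \<Rightarrow> edges \<Rightarrow> bool" where
  "tree n E \<longleftrightarrow> simple_graph n E \<and> connected_graph n E \<and> (\<nexists>p. cycle E p)"

text \<open>The inner sum over the two elements of an edge \<open>{u, v}\<close> is
  \<open>(deg E u)\<^sup>2 + (deg E v)\<^sup>2\<close>.\<close>

definition sombor_index :: "edges \<Rightarrow> real" where
  "sombor_index E = (\<Sum>e\<in>E. sqrt (\<Sum>u\<in>e. (real (deg E u))\<^sup>2))"

text \<open>A sequence \<open>(d\<^sub>1, \<dots>, d\<^sub>n)\<close> is a function \<open>d\<close> of which only the values on \<open>{1..n}\<close> matter.\<close>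

definition trees_with_degrees :: "nat \<Rightarrow> (nat \<Rightarrow> nat) \<Rightarrow> edges set" where
  "trees_with_degrees n d = {E. tree n E \<and> (\<forall>u\<in>{1..n}. deg E u = d u)}"

definition num_children :: "(nat \<Rightarrow> nat) \<Rightarrow> nat \<Rightarrow> nat" where
  "num_children d u = (if u = 1 then d u else d u - 1)"

text \<open>In breadth-first order the labels \<open>2, 3, \<dots>\<close> are handed out as children to the vertices
  \<open>1, 2, \<dots>\<close> in turn, so the children of \<open>u\<close> come right after the root and all
  children of the vertices before \<open>u\<close>.\<close>

definition first_child :: "(nat \<Rightarrow> nat) \<Rightarrow> nat \<Rightarrow> nat" where
  "first_child d u = 2 + (\<Sum>w=1..<u. num_children d w)"

definition children :: "(nat \<Rightarrow> nat) \<Rightarrow> nat \<Rightarrow> nat set" where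
  "children d u = {first_child d u ..< first_child d u + num_children d u}"

definition greedy_tree :: "nat \<Rightarrow> (nat \<Rightarrow> nat) \<Rightarrow> edges" where
  "greedy_tree n d = {{u, v} | u v. u \<in> {1..n} \<and> v \<in> children d u}"

lemma children_1: "children d 1 = {2..d 1 + 1}"
  by (auto simp: children_def first_child_def num_children_def)

lemma children_2: "d 2 \<ge> 1 \<Longrightarrow> children d 2 = {d 1 + 2..d 1 + d 2}"
  by (auto simp: children_def first_child_def num_children_def numeral_2_eq_2)

lemma first_child_Suc: "u \<ge> 1 \<Longrightarrow> first_child d (Suc u) = first_child d u + num_children d u"
  by (simp add: first_child_def)

end

theory Submission
  imports Defs
begin

text \<open>The theorem is proved for edge weights \<open>sqrt (w u\<^sup>2 + w v\<^sup>2)\<close>, where \<open>w\<close> is any non-negative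
  non-increasing function of the label; decoupling \<open>w\<close> from the degrees allows induction on \<open>n\<close>.
  The last vertex \<open>n\<close> is a leaf, and in the greedy tree its neighbour is the last vertex \<open>k\<close> that
  has children. If it hangs on some \<open>u \<noteq> k\<close> in a tree \<open>T\<close>, then \<open>u < k\<close>, and \<open>k\<close> has a neighbour
  \<open>x\<close> off the path from \<open>k\<close> to \<open>u\<close>. Replacing the edges \<open>un\<close>, \<open>kx\<close> by \<open>ux\<close>, \<open>kn\<close> gives a tree with
  the same degrees, and by submodularity of \<open>sqrt (a\<^sup>2 + b\<^sup>2)\<close> its weight is not larger, since
  \<open>w u \<ge> w k\<close> and \<open>w x \<ge> w n\<close>. Now remove the leaf \<open>n\<close> from both trees.\<close>

section \<open>Forests\<close>

abbreviation adj :: "edges \<Rightarrow> (nat \<times> nat) set" where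
  "adj E \<equiv> {(x, y). {x, y} \<in> E}"

text \<open>Acyclicity in the form "every edge is a bridge". Unlike cycles given as lists, this form
  passes easily through deletion and insertion of single edges.\<close>

definition forest :: "edges \<Rightarrow> bool" where
  "forest E \<longleftrightarrow> (\<forall>a b. {a, b} \<in> E \<longrightarrow> (a, b) \<notin> (adj (E - {{a, b}}))\<^sup>*)"

lemma rtrancl_adj_sym: "(x, y) \<in> (adj E)\<^sup>* \<Longrightarrow> (y, x) \<in> (adj E)\<^sup>*"
proof -
  have "sym (adj E)"
    by (auto simp: sym_def insert_commute)
  then show "(x, y) \<in> (adj E)\<^sup>* \<Longrightarrow> (y, x) \<in> (adj E)\<^sup>*"
    by (meson sym_rtrancl symD)
qed

lemma rtrancl_adj_mono:
  assumes "E \<subseteq> F" and "(x, y) \<in> (adj E)\<^sup>*"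
  shows "(x, y) \<in> (adj F)\<^sup>*"
proof -
  have "adj E \<subseteq> adj F"
    using assms(1) by auto
  then show ?thesis
    using assms(2) rtrancl_mono by blast
qed

text \<open>The path is built backwards from \<open>b\<close>; when the new start already lies on
  it, the part before that occurrence is dropped.\<close>

lemma rtrancl_imp_distinct_path:
  assumes "(a, b) \<in> r\<^sup>*"
  shows "\<exists>p. p \<noteq> [] \<and> hd p = a \<and> last p = b \<and> distinct p \<and> successively (\<lambda>x y. (x, y) \<in> r) p"
  using assms
proof (induction rule: converse_rtrancl_induct)
  case base
  show ?case
    by (intro exI[of _ "[b]"]) simp
next
  case (step y z)
  then obtain p where p: "p \<noteq> []" "hd p = z" "last p = b" "distinct p"
    "successively (\<lambda>x y. (x, y) \<in> r) p"
    by blast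
  show ?case
  proof (cases "y \<in> set p")
    case True
    then obtain q s where "p = q @ y # s"
      by (meson split_list)
    with p show ?thesis
      by (intro exI[of _ "y # s"]) (auto simp: successively_append_iff)
  next
    case False
    with p step.hyps show ?thesis
      by (intro exI[of _ "y # p"]) (auto simp: successively_Cons)
  qed
qed

text \<open>A simple path joining the ends of an edge without using that edge has at least three
  vertices, and the edge closes it to a cycle.\<close>

lemma forest_if_no_cycle:
  assumes "\<nexists>p. cycle E p" and "simple_graph n E"
  shows "forest E"
  unfolding forest_def
proof (intro allI impI notI)
  fix a b
  assume ab: "{a, b} \<in> E" and con: "(a, b) \<in> (adj (E - {{a, b}}))\<^sup>*"
  have neq: "a \<noteq> b"
    using ab assms(2) by (force simp: simple_graph_def)
  obtain p where p: "p \<noteq> []" "hd p = a" "last p = b" "distinct p"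
    "successively (\<lambda>x y. (x, y) \<in> adj (E - {{a, b}})) p"
    using rtrancl_imp_distinct_path[OF con] by blast
  have edge: "{p ! i, p ! Suc i} \<in> E - {{a, b}}" if "Suc i < length p" for i
    using p(5) that by (auto simp: successively_conv_nth)
  have ends: "p ! 0 = a" "p ! (length p - 1) = b"
    using p by (simp_all add: hd_conv_nth last_conv_nth)
  have "length p \<noteq> 1"
    using ends neq by auto
  moreover have "length p \<noteq> 2"
    using ends edge[of 0] by auto
  ultimately have len: "3 \<le> length p"
    using p(1) by (cases p; cases "tl p"; cases "tl (tl p)") auto
  have "{p ! i, p ! (Suc i mod length p)} \<in> E" if "i < length p" for i
  proof (cases "Suc i < length p")
    case True
    then show ?thesis
      using edge by auto
  next
    case False
    then have "Suc i = length p"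
      using that by simp
    then have "i = length p - 1" "Suc i mod length p = 0"
      by simp_all
    then show ?thesis
      using ends ab by (simp add: insert_commute)
  qed
  then have "cycle E p"
    using len p(4) by (simp add: cycle_def)
  then show False
    using assms(1) by blast
qed

text \<open>The edge between the last and the first vertex of a cycle is not a bridge: the rest of
  the cycle joins its ends.\<close>

lemma no_cycle_if_forest:
  assumes "forest E"
  shows "\<nexists>p. cycle E p"
proof
  assume "\<exists>p. cycle E p"
  then obtain p where len: "3 \<le> length p" and dist: "distinct p"
    and edge: "\<And>i. i < length p \<Longrightarrow> {p ! i, p ! (Suc i mod length p)} \<in> E"
    by (auto simp: cycle_def)
  define l where "l = length p - 1"
  have l: "2 \<le> l" "length p = Suc l"
    using len by (auto simp: l_def)
  let ?e = "{p ! 0, p ! l}"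
  have "(p ! 0, p ! i) \<in> (adj (E - {?e}))\<^sup>*" if "i \<le> l" for i
    using that
  proof (induction i)
    case 0
    show ?case by simp
  next
    case (Suc i)
    have "{p ! i, p ! Suc i} \<in> E"
      using edge[of i] Suc.prems l by simp
    \<comment> \<open>Since \<open>2 \<le> l\<close>, two consecutive positions are never the first
      and the last one.\<close>
    moreover have "{p ! i, p ! Suc i} \<noteq> ?e"
      using Suc.prems l dist by (auto simp: doubleton_eq_iff nth_eq_iff_index_eq)
    ultimately show ?case
      using Suc by (auto intro: rtrancl_into_rtrancl)
  qed
  then have "(p ! 0, p ! l) \<in> (adj (E - {?e}))\<^sup>*"
    by simp
  moreover have "?e \<in> E"
    using edge[of l] l by (simp add: insert_commute)
  ultimately show False
    using assms by (auto simp: forest_def)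
qed

lemma tree_iff_forest: "tree n E \<longleftrightarrow> simple_graph n E \<and> connected_graph n E \<and> forest E"
  unfolding tree_def using forest_if_no_cycle no_cycle_if_forest by blast

lemma forest_subset: "forest E \<Longrightarrow> F \<subseteq> E \<Longrightarrow> forest F"
  unfolding forest_def
proof (intro allI impI notI)
  fix a b
  assume "\<forall>a b. {a, b} \<in> E \<longrightarrow> (a, b) \<notin> (adj (E - {{a, b}}))\<^sup>*" "F \<subseteq> E" "{a, b} \<in> F"
    "(a, b) \<in> (adj (F - {{a, b}}))\<^sup>*"
  then show False
    using rtrancl_adj_mono[of "F - {{a, b}}" "E - {{a, b}}" a b] by auto
qed

text \<open>A walk can be shortened until it crosses the new edge at most once; the cases are no
  crossing and a crossing in either direction.\<close>

lemma rtrancl_adj_insert: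
  assumes "(a, b) \<in> (adj (insert {u, x} F))\<^sup>*"
  shows "(a, b) \<in> (adj F)\<^sup>* \<or> ((a, u) \<in> (adj F)\<^sup>* \<and> (x, b) \<in> (adj F)\<^sup>*) \<or>
    ((a, x) \<in> (adj F)\<^sup>* \<and> (u, b) \<in> (adj F)\<^sup>*)"
  using assms
proof (induction rule: rtrancl_induct)
  case base
  show ?case by simp
next
  case (step y z)
  have "(y, z) \<in> adj F \<or> (y = u \<and> z = x) \<or> (y = x \<and> z = u)"
    using step.hyps(2) by (auto simp: doubleton_eq_iff)
  then show ?case
  proof (elim disjE conjE)
    assume "(y, z) \<in> adj F"
    then show ?thesis
      using step.IH by (meson rtrancl.rtrancl_into_rtrancl)
  qed (use step.IH in auto)
qed

text \<open>If an old edge \<open>{a, b}\<close> were no longer a bridge, the detour from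
  \<open>a\<close> to \<open>b\<close> would cross \<open>{u, x}\<close>. Its two remaining pieces
  and \<open>{a, b}\<close> itself would then join \<open>u\<close> to \<open>x\<close> inside
  \<open>F\<close>.\<close>

lemma forest_insert:
  assumes "forest F" and "(u, x) \<notin> (adj F)\<^sup>*"
  shows "forest (insert {u, x} F)"
  unfolding forest_def
proof (intro allI impI notI)
  fix a b
  assume ab: "{a, b} \<in> insert {u, x} F"
    and con: "(a, b) \<in> (adj (insert {u, x} F - {{a, b}}))\<^sup>*"
  show False
  proof (cases "{a, b} = {u, x}")
    case True
    then have "(a, b) \<in> (adj F)\<^sup>*"
      by (intro rtrancl_adj_mono[OF _ con]) auto
    then have "(u, x) \<in> (adj F)\<^sup>*"
      using True rtrancl_adj_sym by (auto simp: doubleton_eq_iff)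
    with assms(2) show False ..
  next
    case False
    then have abF: "{a, b} \<in> F"
      using ab by simp
    have eq: "insert {u, x} F - {{a, b}} = insert {u, x} (F - {{a, b}})"
      using False by auto
    let ?r = "(adj (F - {{a, b}}))\<^sup>*"
    have sub: "?r \<subseteq> (adj F)\<^sup>*"
      by (intro rtrancl_mono) auto
    have nab: "(a, b) \<notin> ?r"
      using assms(1) abF by (simp add: forest_def)
    have step: "(a, b) \<in> (adj F)\<^sup>*"
      using abF by auto
    from rtrancl_adj_insert[OF con[unfolded eq]] nab
    consider "(a, u) \<in> (adj F)\<^sup>*" "(x, b) \<in> (adj F)\<^sup>*" | "(a, x) \<in> (adj F)\<^sup>*" "(u, b) \<in> (adj F)\<^sup>*"
      using sub by blast
    then have "(u, x) \<in> (adj F)\<^sup>*"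
      using step rtrancl_adj_sym by (metis (no_types, lifting) rtrancl_trans)
    with assms(2) show False ..
  qed
qed

section \<open>Operations on trees\<close>

lemma simple_graphD:
  assumes "simple_graph n E" and "{a, b} \<in> E"
  shows "a \<in> {1..n}" "b \<in> {1..n}" "a \<noteq> b"
  using assms by (force simp: simple_graph_def)+

lemma finite_simple_graph: "simple_graph n E \<Longrightarrow> finite E"
  by (rule finite_subset[of _ "Pow {1..n}"]) (auto simp: simple_graph_def)

lemma finite_neighbours: "simple_graph n E \<Longrightarrow> finite {v. {u, v} \<in> E}"
  by (rule finite_subset[of _ "{1..n}"]) (auto dest: simple_graphD)

lemma deg_insert:
  assumes "simple_graph n F" and "{a, b} \<notin> F" and "a \<noteq> b"
  shows "deg (insert {a, b} F) v = (if v = a \<or> v = b then Suc (deg F v) else deg F v)"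
proof -
  have "{y. {a, y} \<in> insert {a, b} F} = insert b {y. {a, y} \<in> F}"
    "{y. {b, y} \<in> insert {a, b} F} = insert a {y. {b, y} \<in> F}"
    "v \<noteq> a \<Longrightarrow> v \<noteq> b \<Longrightarrow> {y. {v, y} \<in> insert {a, b} F} = {y. {v, y} \<in> F}"
    using assms(3) by (auto simp: doubleton_eq_iff)
  moreover have "{b, a} \<notin> F"
    using assms(2) by (simp add: insert_commute)
  ultimately show ?thesis
    using assms finite_neighbours[OF assms(1)] by (auto simp: deg_def)
qed

lemma tree_deg_pos:
  assumes "tree n E" and "2 \<le> n" and "u \<in> {1..n}"
  shows "1 \<le> deg E u"
proof -
  \<comment> \<open>A vertex other than \<open>u\<close>: the walk to it has to leave
    \<open>u\<close> along an edge.\<close>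
  have "(if u = 1 then 2 else 1) \<in> {1..n}"
    using assms(2) by auto
  then have "(u, if u = 1 then 2 else 1) \<in> (adj E)\<^sup>*"
    using assms(1,3) unfolding tree_def connected_graph_def by blast
  then obtain v where "{u, v} \<in> E"
    by (cases rule: converse_rtranclE) (auto split: if_splits)
  then have "{v. {u, v} \<in> E} \<noteq> {}"
    by blast
  then show ?thesis
    using assms(1) finite_neighbours[of n E u]
    by (simp add: deg_def tree_def Suc_le_eq card_gt_0_iff)
qed

text \<open>An end of a longest path is a leaf: every further neighbour would either prolong the path or
  close a cycle.\<close>

lemma tree_has_leaf:
  assumes "tree n E" and "1 \<le> n"
  shows "\<exists>u\<in>{1..n}. deg E u \<le> 1"
proof (rule ccontr)
  assume "\<not> ?thesis"
  then have big: "\<And>u. u \<in> {1..n} \<Longrightarrow> 2 \<le> deg E u"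
    by force
  have simple: "simple_graph n E" and acyc: "\<nexists>p. cycle E p"
    using assms by (auto simp: tree_def)
  define P where "P p \<longleftrightarrow> p \<noteq> [] \<and> set p \<subseteq> {1..n} \<and> distinct p \<and>
    successively (\<lambda>x y. {x, y} \<in> E) p" for p
  \<comment> \<open>With all degrees at least 2, a path can always be prolonged at its head, so
    paths of every length exist. One with \<open>n + 1\<close> distinct vertices is absurd.\<close>
  have "\<exists>p. P p \<and> length p = Suc m" for m
  proof (induction m)
    case 0
    show ?case
      using assms(2) by (intro exI[of _ "[1]"]) (auto simp: P_def)
  next
    case (Suc m)
    then obtain p where p: "P p" "length p = Suc m"
      by blast
    then obtain a q where aq: "p = a # q"
      by (cases p) auto
    have "2 \<le> card {v. {a, v} \<in> E}"
      using big[of a] p aq by (simp add: P_def deg_def)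
    \<comment> \<open>For empty \<open>q\<close> the value of \<open>hd q\<close> is arbitrary,
      which is harmless: a set of two or more neighbours does not fit into any singleton.\<close>
    then have "\<not> {v. {a, v} \<in> E} \<subseteq> {hd q}"
      using card_mono[of "{hd q}" "{v. {a, v} \<in> E}"] by auto
    then obtain v where v: "{a, v} \<in> E" "v \<noteq> hd q"
      by blast
    have "v \<notin> set p"
    proof
      assume "v \<in> set p"
      then obtain i where i: "i < length p" "v = p ! i"
        by (auto simp: in_set_conv_nth)
      have "v \<noteq> a"
        using simple_graphD[OF simple v(1)] by simp
      then have "i \<noteq> 0"
        using i aq by (metis nth_Cons_0)
      moreover have "i \<noteq> 1"
      proof
        assume "i = 1"
        then have "v = hd q"
          using i aq by (cases q) auto
        with v(2) show False ..
      qed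
      ultimately have i2: "2 \<le> i"
        by simp
      \<comment> \<open>The initial piece of the path from \<open>a\<close> to \<open>v\<close> is
        closed to a cycle by the edge \<open>{a, v}\<close>.\<close>
      let ?c = "take (Suc i) p"
      have len: "length ?c = Suc i"
        using i by simp
      have "{?c ! j, ?c ! (Suc j mod length ?c)} \<in> E" if "j < length ?c" for j
      proof (cases "j < i")
        case True
        then show ?thesis
          using len i p(1) by (auto simp: P_def successively_conv_nth)
      next
        case False
        then have "j = i"
          using that len by simp
        moreover have "?c ! i = v" "?c ! 0 = a"
          using i aq by (metis lessI nth_take, metis nth_Cons_0 nth_take zero_less_Suc)
        ultimately show ?thesis
          using len v(1) by (simp add: insert_commute)
      qed
      then have "cycle E ?c"
        using len i2 p(1) by (auto simp: cycle_def P_def)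
      with acyc show False by blast
    qed
    moreover have "v \<in> {1..n}"
      using simple_graphD[OF simple v(1)] by simp
    ultimately have "P (v # p)"
      using p v(1) aq by (auto simp: P_def insert_commute)
    with p(2) show ?case
      by (intro exI[of _ "v # p"]) simp
  qed
  then obtain p where p: "P p" "length p = Suc n"
    by blast
  then have "Suc n \<le> card {1..n}"
    by (metis P_def card_mono distinct_card finite_atLeastAtMost)
  then show False
    by simp
qed

lemma tree_remove_leaf:
  assumes "tree (Suc m) E" and "{v. {Suc m, v} \<in> E} = {u}"
  shows "tree m (E - {{u, Suc m}})"
  unfolding tree_iff_forest
proof (intro conjI)
  let ?n = "Suc m" and ?F = "E - {{u, Suc m}}"
  have simple: "simple_graph ?n E" and conn: "connected_graph ?n E" and "forest E"
    using assms(1) by (auto simp: tree_iff_forest)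
  then show "forest ?F"
    by (auto intro: forest_subset)
  have nb: "v = u" if "{?n, v} \<in> E" for v
    using that assms(2) by auto
  show "simple_graph m ?F"
    unfolding simple_graph_def
  proof
    fix e
    assume e: "e \<in> ?F"
    then have c: "card e = 2" "e \<subseteq> {1..?n}"
      using simple by (auto simp: simple_graph_def)
    then obtain a b where ab: "e = {a, b}"
      by (meson card_2_iff)
    have "?n \<notin> e"
    proof
      assume "?n \<in> e"
      then have "e = {?n, a} \<or> e = {?n, b}"
        using ab by auto
      then show False
        using e nb by (auto simp: insert_commute)
    qed
    then show "e \<subseteq> {1..m} \<and> card e = 2"
      using c by (auto simp: atLeastAtMostSuc_conv)
  qed
  \<comment> \<open>Contracting the leaf onto its only neighbour turns walks in \<open>E\<close>
    into walks in \<open>?F\<close> and fixes all other vertices.\<close>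
  define c where "c x = (if x = ?n then u else x)" for x
  have contract: "(c x, c y) \<in> (adj ?F)\<^sup>*" if "(x, y) \<in> (adj E)\<^sup>*" for x y
    using that
  proof (induction rule: rtrancl_induct)
    case base
    show ?case by simp
  next
    case (step y z)
    have "{y, z} \<in> E"
      using step.hyps by simp
    then have "c y = c z \<or> (c y, c z) \<in> adj ?F"
      using nb[of y] nb[of z] by (auto simp: c_def insert_commute doubleton_eq_iff)
    then show ?case
      using step.IH by (metis (no_types, lifting) rtrancl.rtrancl_into_rtrancl)
  qed
  show "connected_graph m ?F"
    unfolding connected_graph_def
  proof (intro ballI)
    fix x y
    assume xy: "x \<in> {1..m}" "y \<in> {1..m}"
    then have "(x, y) \<in> (adj E)\<^sup>*"
      using conn by (auto simp: connected_graph_def)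
    from contract[OF this] show "(x, y) \<in> (adj ?F)\<^sup>*"
      using xy by (simp add: c_def)
  qed
qed

lemma tree_add_leaf:
  assumes "tree m E" and "u \<in> {1..m}"
  shows "tree (Suc m) (insert {u, Suc m} E)"
  unfolding tree_iff_forest
proof (intro conjI)
  let ?n = "Suc m" and ?F = "insert {u, Suc m} E"
  have simple: "simple_graph m E" and conn: "connected_graph m E" and "forest E"
    using assms(1) by (auto simp: tree_iff_forest)
  have "(u, ?n) \<notin> (adj E)\<^sup>*"
  proof
    assume "(u, ?n) \<in> (adj E)\<^sup>*"
    then show False
      using assms(2) by (cases rule: rtranclE) (auto dest: simple_graphD[OF simple])
  qed
  then show "forest ?F"
    using \<open>forest E\<close> by (rule forest_insert[rotated])
  show "simple_graph ?n ?F"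
    using simple assms(2) by (force simp: simple_graph_def)
  have root: "(u, x) \<in> (adj ?F)\<^sup>*" if "x \<in> {1..?n}" for x
  proof (cases "x = ?n")
    case False
    then have "(u, x) \<in> (adj E)\<^sup>*"
      using that conn assms(2) by (auto simp: connected_graph_def)
    then show ?thesis
      by (rule rtrancl_adj_mono[rotated]) auto
  qed auto
  show "connected_graph ?n ?F"
    unfolding connected_graph_def
    using root rtrancl_adj_sym by (meson rtrancl_trans)
qed

text \<open>Deleting the bridge \<open>{k, x}\<close> separates \<open>x\<close> from
  \<open>k\<close>. As \<open>u\<close> lies on the side of \<open>k\<close>, the edge
  \<open>{u, x}\<close> joins the two sides again. The first conclusion also shows that
  \<open>{u, x}\<close> is a new edge.\<close>

lemma tree_swap_edge:
  assumes "tree n (insert {k, x} F)" and "{k, x} \<notin> F"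
    and "(k, u) \<in> (adj F)\<^sup>*" and "u \<in> {1..n}"
  shows "(u, x) \<notin> (adj F)\<^sup>*" and "tree n (insert {u, x} F)"
proof -
  have simple: "simple_graph n (insert {k, x} F)" and conn: "connected_graph n (insert {k, x} F)"
    and forest: "forest (insert {k, x} F)"
    using assms(1) by (auto simp: tree_iff_forest)
  have x: "x \<in> {1..n}"
    using simple_graphD[OF simple, of k x] by simp
  have "(k, x) \<notin> (adj F)\<^sup>*"
    using forest assms(2) unfolding forest_def by (metis Diff_insert_absorb insertI1)
  then show nux: "(u, x) \<notin> (adj F)\<^sup>*"
    using assms(3) by (meson rtrancl_trans)
  then have "u \<noteq> x"
    by auto
  let ?G = "insert {u, x} F"
  have "forest ?G"
    using forest_insert nux forest_subset[OF forest] by blast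
  moreover have "simple_graph n ?G"
    using simple x assms(4) \<open>u \<noteq> x\<close> by (auto simp: simple_graph_def)
  moreover have "connected_graph n ?G"
  proof -
    have "(k, u) \<in> (adj ?G)\<^sup>*"
      by (rule rtrancl_adj_mono[OF _ assms(3)]) auto
    then have kx: "(k, x) \<in> (adj ?G)\<^sup>*"
      by (rule rtrancl_into_rtrancl) auto
    \<comment> \<open>Only the deleted edge \<open>{k, x}\<close> needs a substitute, namely the
      walk from \<open>k\<close> via \<open>u\<close> to \<open>x\<close>.\<close>
    have "adj (insert {k, x} F) \<subseteq> (adj ?G)\<^sup>*"
      using kx rtrancl_adj_sym[OF kx] by (auto simp: doubleton_eq_iff)
    then have "(adj (insert {k, x} F))\<^sup>* \<subseteq> (adj ?G)\<^sup>*"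
      by (metis rtrancl_subset_rtrancl)
    then show ?thesis
      using conn unfolding connected_graph_def by blast
  qed
  ultimately show "tree n ?G"
    by (simp add: tree_iff_forest)
qed

text \<open>A simple path leaves \<open>k\<close> through one neighbour only, so it avoids the edge
  to at least one of two chosen neighbours \<open>x\<close> and \<open>y\<close>.\<close>

lemma neighbour_off_path:
  assumes "(k, u) \<in> (adj E)\<^sup>*" and "2 \<le> deg E k"
  shows "\<exists>x. {k, x} \<in> E \<and> (k, u) \<in> (adj (E - {{k, x}}))\<^sup>*"
proof -
  have "\<not> card {v. {k, v} \<in> E} \<le> Suc 0"
    using assms(2) by (simp add: deg_def)
  \<comment> \<open>An infinite set has \<open>card\<close> 0, so a degree of at least 2 implies
    finiteness.\<close>
  moreover have "finite {v. {k, v} \<in> E}"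
    using assms(2) by (metis card.infinite deg_def not_numeral_le_zero)
  ultimately obtain x y where xy: "{k, x} \<in> E" "{k, y} \<in> E" "x \<noteq> y"
    by (auto simp: card_le_Suc0_iff_eq)
  have "(k, u) \<in> (adj (E - {{k, x}}))\<^sup>* \<or> (k, u) \<in> (adj (E - {{k, y}}))\<^sup>*"
    using assms(1)
  proof (induction rule: rtrancl_induct)
    case base
    show ?case by simp
  next
    case (step v z)
    have first: "(k, x) \<in> adj (E - {{k, y}})" "(k, y) \<in> adj (E - {{k, x}})"
      using xy by (auto simp: doubleton_eq_iff)
    \<comment> \<open>Whenever the walk is at \<open>k\<close>, \<open>x\<close> or
      \<open>y\<close>, its past is replaced by at most one edge at \<open>k\<close>; any other step
      survives both deletions.\<close>
    consider "z = k" | "z = x" | "z = y" | "{v, z} \<noteq> {k, x}" "{v, z} \<noteq> {k, y}"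
      by (auto simp: doubleton_eq_iff)
    then show ?case
    proof cases
      case 4
      then have "(v, z) \<in> adj (E - {{k, x}})" "(v, z) \<in> adj (E - {{k, y}})"
        using step.hyps by auto
      then show ?thesis
        using step.IH by (meson rtrancl.rtrancl_into_rtrancl)
    qed (use first in auto)
  qed
  with xy show ?thesis
    by blast
qed

section \<open>Weighted Sombor index\<close>

definition edge_weight :: "(nat \<Rightarrow> real) \<Rightarrow> nat set \<Rightarrow> real" where
  "edge_weight w e = sqrt (\<Sum>u\<in>e. (w u)\<^sup>2)"

lemma edge_weight_pair: "a \<noteq> b \<Longrightarrow> edge_weight w {a, b} = sqrt ((w a)\<^sup>2 + (w b)\<^sup>2)"
  by (simp add: edge_weight_def)

text \<open>After squaring, the equal sums cancel and only the products under the root remain to be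
  compared.\<close>

lemma sqrt_add_le_sqrt_add:
  fixes p q r s :: real
  assumes "0 \<le> p" "0 \<le> q" "0 \<le> r" "0 \<le> s" and "p + s = q + r" and "p * s \<le> q * r"
  shows "sqrt p + sqrt s \<le> sqrt q + sqrt r"
proof (rule power2_le_imp_le)
  have "sqrt (p * s) \<le> sqrt (q * r)"
    using assms(6) by simp
  then show "(sqrt p + sqrt s)\<^sup>2 \<le> (sqrt q + sqrt r)\<^sup>2"
    using assms by (simp add: power2_sum real_sqrt_mult)
qed (use assms in simp)

lemma sqrt_sum_squares_submodular:
  fixes a b c e :: real
  assumes "0 \<le> c" "c \<le> a" "0 \<le> e" "e \<le> b"
  shows "sqrt (a\<^sup>2 + b\<^sup>2) + sqrt (c\<^sup>2 + e\<^sup>2) \<le> sqrt (a\<^sup>2 + e\<^sup>2) + sqrt (c\<^sup>2 + b\<^sup>2)"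
proof (rule sqrt_add_le_sqrt_add)
  \<comment> \<open>This product is exactly the difference of the two products of radicands.\<close>
  have "0 \<le> (a\<^sup>2 - c\<^sup>2) * (b\<^sup>2 - e\<^sup>2)"
    using assms by (intro mult_nonneg_nonneg) (auto intro: power_mono)
  then show "(a\<^sup>2 + b\<^sup>2) * (c\<^sup>2 + e\<^sup>2) \<le> (a\<^sup>2 + e\<^sup>2) * (c\<^sup>2 + b\<^sup>2)"
    by (simp add: algebra_simps)
qed auto

section \<open>Removing the last leaf\<close>

text \<open>Lowering the degree of the last parent \<open>k\<close> shortens its block of children
  by one label and moves no block before it; the later blocks are empty. The second conclusion
  restores \<open>total\<close> for the next size.\<close>

lemma greedy_tree_Suc:
  assumes k: "k \<in> {1..m}" and pos: "0 < num_children d k"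
    and zero: "\<And>v. k < v \<Longrightarrow> v \<le> Suc m \<Longrightarrow> num_children d v = 0"
    and total: "(\<Sum>v=1..m. num_children (d(k := d k - 1)) v) = m - 1"
  shows "greedy_tree (Suc m) d = insert {k, Suc m} (greedy_tree m (d(k := d k - 1)))"
    and "(\<Sum>v=1..Suc m. num_children d v) = m"
proof -
  let ?d = "d(k := d k - 1)"
  have nc: "num_children ?d v = num_children d v" if "v \<noteq> k" for v
    using that by (simp add: num_children_def)
  have nck: "num_children d k = Suc (num_children ?d k)"
    using pos by (auto simp: num_children_def split: if_splits)
  have fc: "first_child ?d v = first_child d v" if "v \<le> k" for v
    using that nc by (simp add: first_child_def)
  have split: "{1..m} = {1..<k} \<union> {k} \<union> {k<..m}"
    using k by auto
  have "(\<Sum>v=1..m. num_children ?d v)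
      = (\<Sum>v=1..<k. num_children ?d v) + num_children ?d k + (\<Sum>v\<in>{k<..m}. num_children ?d v)"
    unfolding split by (subst sum.union_disjoint; force)+
  also have "(\<Sum>v\<in>{k<..m}. num_children ?d v) = 0"
    using zero nc by simp
  \<comment> \<open>Labels are handed out from 2 on, and \<open>m - 1\<close> of them are used by
    \<open>?d\<close>, so \<open>Suc m\<close> is the first free label.\<close>
  finally have last: "first_child d k + num_children ?d k = Suc m"
    using total k fc[of k, symmetric] unfolding first_child_def
    by (simp del: fun_upd_apply)
  have chk: "children d k = insert (Suc m) (children ?d k)"
    using last nck fc[of k] by (auto simp: children_def)
  have chl: "children ?d v = children d v" if "v < k" for v
    using that nc[of v] fc[of v] by (simp add: children_def)
  have chg: "children d v = {}" "children ?d v = {}" if "k < v" "v \<le> Suc m" for v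
    using that nc[of v] zero[of v] by (simp_all add: children_def)
  have ch: "v \<in> {1..Suc m} \<and> y \<in> children d v \<longleftrightarrow>
      (v = k \<and> y = Suc m) \<or> v \<in> {1..m} \<and> y \<in> children ?d v" for v y
    using k chk chl[of v] chg[of v] by (cases v k rule: linorder_cases) auto
  show "greedy_tree (Suc m) d = insert {k, Suc m} (greedy_tree m ?d)"
    unfolding greedy_tree_def ch by blast
  have "(\<Sum>v=1..Suc m. num_children d v) = (\<Sum>v=1..m. num_children d v)"
    using zero[of "Suc m"] k by simp
  also have "\<dots> = num_children d k + (\<Sum>v\<in>{1..m} - {k}. num_children d v)"
    using k by (simp add: sum.remove)
  also have "(\<Sum>v\<in>{1..m} - {k}. num_children d v) = (\<Sum>v\<in>{1..m} - {k}. num_children ?d v)"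
    using nc by (intro sum.cong) auto
  also have "num_children d k + \<dots> = Suc (\<Sum>v=1..m. num_children ?d v)"
    using k nck by (simp add: sum.remove)
  finally show "(\<Sum>v=1..Suc m. num_children d v) = m"
    using total k by simp
qed

text \<open>The vertex \<open>k\<close> depends on \<open>d\<close> alone and hence fits the greedy
  tree whatever \<open>T\<close> is. The leaf is removed first and the edge at \<open>x\<close> is
  moved in the smaller tree, so \<open>{k, Suc m}\<close> occurs only in the weight
  estimate.\<close>

lemma tree_exchange:
  assumes T: "T \<in> trees_with_degrees (Suc m) d" and m: "1 \<le> m"
    and anti: "antimono_on {1..Suc m} d"
    and w: "antimono_on {1..Suc m} w" "\<And>v. v \<in> {1..Suc m} \<Longrightarrow> 0 \<le> w v"
  obtains k E where "k \<in> {1..m}" "0 < num_children d k"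
    "\<And>v. k < v \<Longrightarrow> v \<le> Suc m \<Longrightarrow> num_children d v = 0"
    "E \<in> trees_with_degrees m (d(k := d k - 1))"
    "sum (edge_weight w) E + edge_weight w {k, Suc m} \<le> sum (edge_weight w) T"
    "d (Suc m) = 1"
proof -
  let ?n = "Suc m"
  have tree: "tree ?n T" and degT: "\<And>v. v \<in> {1..?n} \<Longrightarrow> deg T v = d v"
    using T by (auto simp: trees_with_degrees_def)
  have simpleT: "simple_graph ?n T"
    using tree by (simp add: tree_def)
  obtain l where l: "l \<in> {1..?n}" "deg T l \<le> 1"
    using tree_has_leaf[OF tree] by auto
  have "d ?n \<le> d l"
    using anti l(1) by (auto simp: monotone_on_def)
  moreover have "1 \<le> d ?n"
    using tree_deg_pos[OF tree, of ?n] degT[of ?n] m by auto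
  ultimately have dn: "d ?n = 1"
    using l degT by simp
  then have "card {v. {?n, v} \<in> T} = 1"
    using degT[of ?n] by (simp add: deg_def)
  then obtain u where u: "{v. {?n, v} \<in> T} = {u}"
    by (meson card_1_singletonE)
  define F where "F = T - {{u, ?n}}"
  have un: "{u, ?n} \<in> T"
    using u by (auto simp: insert_commute)
  then have TF: "T = insert {u, ?n} F" and unF: "{u, ?n} \<notin> F"
    by (auto simp: F_def)
  have treeF: "tree m F"
    unfolding F_def by (rule tree_remove_leaf[OF tree u])
  then have simpleF: "simple_graph m F"
    by (simp add: tree_def)
  have u_ne: "u \<noteq> ?n" and um: "u \<in> {1..m}"
    using simple_graphD[OF simpleT un] by auto
  have degF: "deg F v = (if v = u then d v - 1 else d v)" if "v \<in> {1..m}" for v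
    using that deg_insert[OF simpleF unF u_ne, of v] degT[of v] TF by (auto split: if_splits)
  have du: "d u = Suc (deg F u)"
    using deg_insert[OF simpleF unF u_ne, of u] degT[of u] TF um by simp
  \<comment> \<open>If \<open>u\<close> is not the root, the tree \<open>F\<close> has at least two
    vertices, so \<open>u\<close> keeps an edge there besides the one to the leaf.\<close>
  have ncu: "0 < num_children d u"
  proof (cases "u = 1")
    case False
    then have "1 \<le> deg F u"
      using um by (intro tree_deg_pos[OF treeF]) auto
    then show ?thesis
      using du False by (simp add: num_children_def)
  qed (use du in \<open>simp add: num_children_def\<close>)
  define K where "K = {v \<in> {1..?n}. 0 < num_children d v}"
  define k where "k = Max K"
  have finK: "finite K" and uK: "u \<in> K"
    using ncu um by (auto simp: K_def)
  then have kK: "k \<in> K" and uk: "u \<le> k"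
    unfolding k_def using Max_in by auto
  have zero: "num_children d v = 0" if "k < v" "v \<le> ?n" for v
  proof (rule ccontr)
    assume "num_children d v \<noteq> 0"
    then have "v \<in> K"
      using that by (simp add: K_def)
    then show False
      using that(1) Max_ge[OF finK] by (simp add: k_def leD)
  qed
  have "num_children d ?n = 0"
    using dn m by (simp add: num_children_def)
  then have km: "k \<in> {1..m}" and nck: "0 < num_children d k"
    using kK by (auto simp: K_def le_Suc_eq)
  have sumT: "sum (edge_weight w) T = edge_weight w {u, ?n} + sum (edge_weight w) F"
    using TF unF finite_simple_graph[OF simpleF] by simp
  show ?thesis
  proof (cases "u = k")
    case True
    have "F \<in> trees_with_degrees m (d(k := d k - 1))"
      using treeF degF True by (auto simp: trees_with_degrees_def)
    then show ?thesis
      using that[OF km nck zero _ _ dn, of F] sumT True by simp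
  next
    case False
    \<comment> \<open>Here \<open>u < k\<close>, so \<open>k\<close> is not the root and its child
      count is \<open>d k - 1\<close>.\<close>
    then have "2 \<le> d k"
      using uk um nck by (auto simp: num_children_def split: if_splits)
    then have "2 \<le> deg F k"
      using degF[OF km] False by simp
    moreover have "(k, u) \<in> (adj F)\<^sup>*"
      using treeF km um by (auto simp: tree_def connected_graph_def)
    ultimately obtain x where kx: "{k, x} \<in> F" and ku: "(k, u) \<in> (adj (F - {{k, x}}))\<^sup>*"
      using neighbour_off_path by blast
    define H where "H = F - {{k, x}}"
    have FH: "F = insert {k, x} H" and kxH: "{k, x} \<notin> H"
      using kx by (auto simp: H_def)
    have simpleH: "simple_graph m H"
      using simpleF by (auto simp: H_def simple_graph_def)
    let ?E = "insert {u, x} H"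
    have uxcon: "(u, x) \<notin> (adj H)\<^sup>*" and treeE: "tree m ?E"
      using tree_swap_edge[OF treeF[unfolded FH] kxH _ um] ku by (auto simp: H_def)
    have uxH: "{u, x} \<notin> H" and ux: "u \<noteq> x"
      using uxcon by auto
    have kx_ne: "k \<noteq> x" and xm: "x \<in> {1..m}"
      using simple_graphD[OF simpleF kx] by auto
    \<comment> \<open>At \<open>u\<close> the edge to \<open>x\<close> replaces the one to the leaf,
      at \<open>x\<close> one neighbour replaces another, and \<open>k\<close> loses an
      edge.\<close>
    have "deg ?E v = (d(k := d k - 1)) v" if "v \<in> {1..m}" for v
      using degF[OF that] du False kx_ne ux
        deg_insert[OF simpleH uxH ux, of v] deg_insert[OF simpleH kxH kx_ne, of v]
      unfolding FH[symmetric] by (auto split: if_splits)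
    then have "?E \<in> trees_with_degrees m (d(k := d k - 1))"
      using treeE by (simp add: trees_with_degrees_def)
    moreover have "sum (edge_weight w) ?E + edge_weight w {k, ?n} \<le> sum (edge_weight w) T"
    proof -
      have "w k \<le> w u" "w ?n \<le> w x" "0 \<le> w k" "0 \<le> w ?n"
        using w uk um km xm by (auto simp: monotone_on_def)
      then have "edge_weight w {u, x} + edge_weight w {k, ?n}
          \<le> edge_weight w {u, ?n} + edge_weight w {k, x}"
        using sqrt_sum_squares_submodular[of "w k" "w u" "w ?n" "w x"] ux kx_ne u_ne km
        by (simp add: edge_weight_pair)
      moreover have "sum (edge_weight w) F = edge_weight w {k, x} + sum (edge_weight w) H"
        unfolding FH using kxH finite_simple_graph[OF simpleH] by simp
      moreover have "sum (edge_weight w) ?E = edge_weight w {u, x} + sum (edge_weight w) H"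
        using uxH finite_simple_graph[OF simpleH] by simp
      ultimately show ?thesis
        using sumT by simp
    qed
    ultimately show ?thesis
      using that[OF km nck zero _ _ dn] by blast
  qed
qed

section \<open>Induction on the number of vertices\<close>

text \<open>The weight \<open>w\<close> stays fixed while \<open>d\<close> varies. The number of
  children is carried along because \<open>greedy_tree_Suc\<close> uses it to identify the label of
  the last child.\<close>

lemma greedy_tree_minimal:
  assumes "1 \<le> n" and "antimono_on {1..n} d" and "T \<in> trees_with_degrees n d"
    and "antimono_on {1..n} w" and "\<And>v. v \<in> {1..n} \<Longrightarrow> 0 \<le> w v"
  shows "greedy_tree n d \<in> trees_with_degrees n d \<and> (\<Sum>v=1..n. num_children d v) = n - 1 \<and>
    sum (edge_weight w) (greedy_tree n d) \<le> sum (edge_weight w) T"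
  using assms
proof (induction n arbitrary: d T rule: nat_induct_at_least)
  case base
  have "T = {}"
  proof (rule ccontr)
    have "simple_graph 1 T"
      using base.prems(2) by (simp add: trees_with_degrees_def tree_def)
    moreover assume "T \<noteq> {}"
    ultimately obtain e :: "nat set" where "e \<subseteq> {1..1}" "card e = 2"
      unfolding simple_graph_def by (metis ex_in_conv)
    then show False
      using card_mono[of "{1..1::nat}" e] by simp
  qed
  moreover have "d 1 = 0"
    using base calculation by (auto simp: trees_with_degrees_def deg_def)
  moreover have "greedy_tree 1 d = {}"
    using \<open>d 1 = 0\<close> by (auto simp: greedy_tree_def children_def num_children_def)
  ultimately show ?case
    using base by (simp add: num_children_def)
next
  case (Suc m)
  obtain k E where k: "k \<in> {1..m}" "0 < num_children d k"
    and zero: "\<And>v. k < v \<Longrightarrow> v \<le> Suc m \<Longrightarrow> num_children d v = 0"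
    and E: "E \<in> trees_with_degrees m (d(k := d k - 1))"
    and le: "sum (edge_weight w) E + edge_weight w {k, Suc m} \<le> sum (edge_weight w) T"
    and dn: "d (Suc m) = 1"
    using tree_exchange[OF Suc.prems(2) Suc.hyps(1) Suc.prems(1,3,4)] by blast
  let ?d = "d(k := d k - 1)"
  have "antimono_on {1..m} ?d"
  proof (rule monotone_onI)
    fix i j
    assume ij: "i \<in> {1..m}" "j \<in> {1..m}" "i \<le> j"
    have dij: "d j \<le> d i"
      using Suc.prems(1) ij by (auto simp: monotone_on_def)
    show "?d j \<le> ?d i"
    \<comment> \<open>The only critical case for monotonicity: a later \<open>j\<close> has no
      children, hence degree at most 1, while \<open>k\<close> keeps an edge in the tree
      \<open>E\<close>.\<close>
    proof (cases "i = k \<and> k < j")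
      case True
      then have "1 \<le> deg E k"
        using E ij by (intro tree_deg_pos[of m]) (auto simp: trees_with_degrees_def)
      then have "1 \<le> ?d k"
        using E k by (auto simp: trees_with_degrees_def)
      moreover have "d j \<le> 1"
        using zero[of j] True ij by (auto simp: num_children_def split: if_splits)
      ultimately show ?thesis
        using True by simp
    qed (use dij ij in auto)
  qed
  moreover have w: "antimono_on {1..m} w" "\<And>v. v \<in> {1..m} \<Longrightarrow> 0 \<le> w v"
    using Suc.prems(3,4) by (auto simp: monotone_on_def)
  ultimately have IH: "greedy_tree m ?d \<in> trees_with_degrees m ?d"
    "(\<Sum>v=1..m. num_children ?d v) = m - 1"
    "sum (edge_weight w) (greedy_tree m ?d) \<le> sum (edge_weight w) E"
    using Suc.IH[OF _ E w] by blast+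
  note greedy = greedy_tree_Suc[OF k zero IH(2)]
  let ?G = "greedy_tree m ?d"
  have simple: "simple_graph m ?G" and tree: "tree m ?G"
    and degG: "\<And>v. v \<in> {1..m} \<Longrightarrow> deg ?G v = ?d v"
    using IH(1) by (auto simp: trees_with_degrees_def tree_def)
  have notin: "{k, Suc m} \<notin> ?G"
    using simple_graphD[OF simple, of k "Suc m"] by auto
  have "{v. {Suc m, v} \<in> ?G} = {}"
    using simple_graphD(1)[OF simple, of "Suc m"] by auto
  then have "deg ?G (Suc m) = 0"
    unfolding deg_def by (simp only: card.empty)
  \<comment> \<open>Positivity makes the subtraction in \<open>d k - 1\<close> exact, so that
    attaching the leaf restores \<open>d k\<close>.\<close>
  moreover have "0 < d k"
    using k(2) by (auto simp: num_children_def split: if_splits)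
  ultimately have "deg (insert {k, Suc m} ?G) v = d v" if "v \<in> {1..Suc m}" for v
    using that deg_insert[OF simple notin, of v] degG[of v] dn k(1)
    by (cases "v = Suc m") auto
  then have "insert {k, Suc m} ?G \<in> trees_with_degrees (Suc m) d"
    using tree_add_leaf[OF tree k(1)] by (simp add: trees_with_degrees_def)
  moreover have "sum (edge_weight w) (insert {k, Suc m} ?G)
      = edge_weight w {k, Suc m} + sum (edge_weight w) ?G"
    using notin finite_simple_graph[OF simple] by simp
  ultimately show ?case
    using greedy IH(3) le by simp
qed

section \<open>Specialisation of the weights to the degrees\<close>

lemma sombor_index_eq_sum_edge_weight:
  assumes "T \<in> trees_with_degrees n d"
  shows "sombor_index T = sum (edge_weight (\<lambda>v. real (d v))) T"
  unfolding sombor_index_def edge_weight_def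
proof (intro sum.cong refl arg_cong[where f = sqrt])
  fix e u
  assume "e \<in> T" "u \<in> e"
  then have "u \<in> {1..n}"
    using assms unfolding trees_with_degrees_def tree_def simple_graph_def by blast
  then show "(real (deg T u))\<^sup>2 = (real (d u))\<^sup>2"
    using assms by (simp add: trees_with_degrees_def)
qed

theorem theorem1:
  fixes n :: nat and d :: "nat \<Rightarrow> nat"
  assumes "n \<ge> 1"
    and "antimono_on {1..n} d"
    and "trees_with_degrees n d \<noteq> {}"
  shows "greedy_tree n d \<in> trees_with_degrees n d \<and>
    (\<forall>T\<in>trees_with_degrees n d. sombor_index (greedy_tree n d) \<le> sombor_index T)"
proof -
  have "antimono_on {1..n} (\<lambda>v. real (d v))"
    using assms(2) by (simp add: monotone_on_def)
  then have min: "greedy_tree n d \<in> trees_with_degrees n d \<and>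
      sum (edge_weight (\<lambda>v. real (d v))) (greedy_tree n d) \<le> sum (edge_weight (\<lambda>v. real (d v))) T"
    if "T \<in> trees_with_degrees n d" for T
    using greedy_tree_minimal[OF assms(1,2) that, of "\<lambda>v. real (d v)"] by simp
  then have "greedy_tree n d \<in> trees_with_degrees n d"
    using assms(3) by blast
  with min show ?thesis
    by (simp add: sombor_index_eq_sum_edge_weight)
qed

end
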